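(* Let $\mathbb K$ be a field and let $q\in\mathbb K$ be nonzero with $q^2\neq 1$. Let $y$ be the element of $U_q(\mathfrak{sl}_2)$, and $\Gamma_y$ the $U_q(\mathfrak{sl}_2)$-module with basis $u_{ij}$ ($i,j\in\mathbb Z$, $j\ge 0$), described in the context. Then: (i) $yu_{00}=0$; (ii) $y$ is not invertible on $\Gamma_y$; (iii) $y$ is not invertible in $U_q(\mathfrak{sl}_2)$.
   Context: $U_q(\mathfrak{sl}_2)$ denotes the unital associative $\mathbb K$-algebra with generators $k^{\pm1},e,f$ and relations $kk^{-1}=k^{-1}k=1$, $ke=q^2ek$, $kf=q^{-2}fk$, $ef-fe=\frac{k-k^{-1}}{q-q^{-1}}$. Its equitable generators are the elements $x^{\pm1}=k^{\pm1}$, $y=k^{-1}+f(q-q^{-1})$, $z=k^{-1}-k^{-1}e\,q(q-q^{-1})$; in terms of them $U_q(\mathfrak{sl}_2)$ is presented by the relations $xx^{-1}=x^{-1}x=1$, $\frac{qxy-q^{-1}yx}{q-q^{-1}}=\frac{qyz-q^{-1}zy}{q-q^{-1}}=\frac{qzx-q^{-1}xz}{q-q^{-1}}=1$ (the equitable presentation). $\Gamma_y$ is the $U_q(\mathfrak{sl}_2)$-module with basis $u_{ij}$ ($i,j\in\mathbb Z$, $j\geq0$) on which, with the convention $u_{r,-1}:=0$ for $r\in\mathbb Z$, $$xu_{ij}=u_{i+1,j},\qquad x^{-1}u_{ij}=u_{i-1,j},$$ $$yu_{ij}=q^{2i-j}(q^j-q^{-j})u_{i,j-1}-q^i(q^i-q^{-i})u_{i-1,j},$$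 $$zu_{ij}=q^{-2i}u_{i,j+1}+q^{-i}(q^i-q^{-i})u_{i-1,j}.$$ *)

theory Defs
  imports Complex_Main "HOL-Library.Poly_Mapping" "HOL-Algebra.QuotRing"
begin

section \<open>Vector spaces of finitely supported functions\<close>

definition scale :: "'k::field \<Rightarrow> ('a \<Rightarrow>\<^sub>0 'k) \<Rightarrow> ('a \<Rightarrow>\<^sub>0 'k)" where
  "scale c v = Poly_Mapping.map (\<lambda>t. c * t) v"

text \<open>The linear map determined by the images \<open>T a\<close> of the basis vectors \<open>single a 1\<close>.\<close>

definition extend :: "('a \<Rightarrow> ('b \<Rightarrow>\<^sub>0 'k)) \<Rightarrow> ('a \<Rightarrow>\<^sub>0 'k::field) \<Rightarrow> ('b \<Rightarrow>\<^sub>0 'k)" where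
  "extend T v = (\<Sum>a\<in>Poly_Mapping.keys v. scale (Poly_Mapping.lookup v a) (T a))"

definition End_ring :: "(('a \<Rightarrow>\<^sub>0 'k::field) \<Rightarrow> ('a \<Rightarrow>\<^sub>0 'k)) ring" where
  "End_ring = \<lparr>carrier = {f. Vector_Spaces.linear scale scale f},
     mult = (\<circ>), one = id, zero = (\<lambda>_. 0), add = (\<lambda>f g v. f v + g v)\<rparr>"

lemma lookup_scale [simp]: "Poly_Mapping.lookup (scale c v) a = c * Poly_Mapping.lookup v a"
  by (simp add: scale_def Poly_Mapping.map.rep_eq when_def)

lemma scale_simps:
  "scale c (v + w) = scale c v + scale c w" "scale (c + d) v = scale c v + scale d v"
  "scale c (scale d v) = scale (c * d) v" "scale 1 v = v" "scale 0 v = 0" "scale c 0 = 0"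
  "scale c (v - w) = scale c v - scale c w"
  by (rule poly_mapping_eqI, simp add: lookup_add lookup_minus algebra_simps)+

lemma vector_space_scale: "vector_space (scale :: 'k::field \<Rightarrow> ('a \<Rightarrow>\<^sub>0 'k) \<Rightarrow> _)"
  by unfold_locales (simp_all add: scale_simps)

lemma linear_scale_iff:
  "Vector_Spaces.linear scale scale f \<longleftrightarrow>
    (\<forall>v w. f (v + w) = f v + f w) \<and> (\<forall>c v. f (scale c v) = scale c (f v))"
  by (auto simp: Vector_Spaces.linear_def module_hom_def module_hom_axioms_def vector_space_scale
      module_iff_vector_space)

lemma linearD:
  assumes "Vector_Spaces.linear scale scale f"
  shows "f (v + w) = f v + f w" "f (scale c v) = scale c (f v)" "f 0 = 0" "f (v - w) = f v - f w"
proof -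
  show 1: "f (v + w) = f v + f w" and 2: "f (scale c v) = scale c (f v)" for v w c
    using assms by (simp_all add: linear_scale_iff)
  show "f 0 = 0" using 2[of 0 0] by (simp add: scale_simps)
  show "f (v - w) = f v - f w" using 1[of "v - w" w] by (simp add: algebra_simps)
qed

lemma extend_superset:
  assumes "finite S" "Poly_Mapping.keys v \<subseteq> S"
  shows "extend T v = (\<Sum>a\<in>S. scale (Poly_Mapping.lookup v a) (T a))"
  unfolding extend_def using assms
  by (intro sum.mono_neutral_left) (auto simp: in_keys_iff scale_simps)

lemma linear_extend:
  fixes T :: "'a \<Rightarrow> ('c \<Rightarrow>\<^sub>0 'b::field)"
  shows "Vector_Spaces.linear scale scale (extend T)"
  unfolding linear_scale_iff
proof safe
  fix v w :: "'a \<Rightarrow>\<^sub>0 'b::field" and c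
  let ?S = "Poly_Mapping.keys v \<union> Poly_Mapping.keys w"
  have "Poly_Mapping.keys (v + w) \<subseteq> ?S" by (rule keys_add)
  then show "extend T (v + w) = extend T v + extend T w"
    by (simp add: extend_superset[of ?S] lookup_add scale_simps sum.distrib)
  have "Poly_Mapping.keys (scale c v) \<subseteq> Poly_Mapping.keys v" by (auto simp: in_keys_iff)
  moreover have "scale c (\<Sum>a\<in>A. g a) = (\<Sum>a\<in>A. scale c (g a))" for A :: "'a set" and g :: "'a \<Rightarrow> ('c \<Rightarrow>\<^sub>0 'b)"
    by (induction A rule: infinite_finite_induct) (simp_all add: scale_simps)
  ultimately show "extend T (scale c v) = scale c (extend T v)"
    by (simp add: extend_superset[of "Poly_Mapping.keys v"] scale_simps)
qed

lemma extend_single [simp]: "extend T (Poly_Mapping.single a c) = scale c (T a)"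
  by (simp add: extend_superset[of "{a}"])

lemma pm_induct [case_names single add]:
  fixes P :: "('a \<Rightarrow>\<^sub>0 'k::comm_monoid_add) \<Rightarrow> bool"
  assumes single: "\<And>a c. P (Poly_Mapping.single a c)"
    and add: "\<And>v w. P v \<Longrightarrow> P w \<Longrightarrow> P (v + w)"
  shows "P v"
proof -
  have P0: "P 0" using single[of undefined 0] by simp
  have "P (\<Sum>a\<in>S. Poly_Mapping.single a (Poly_Mapping.lookup v a))" for S
    by (induction S rule: infinite_finite_induct) (simp_all add: P0 single add)
  moreover have "v = (\<Sum>a\<in>Poly_Mapping.keys v. Poly_Mapping.single a (Poly_Mapping.lookup v a))"
    by (rule poly_mapping_eqI) (auto simp: lookup_sum lookup_single when_def in_keys_iff)
  ultimately show ?thesis by metis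
qed

lemma scale_single [simp]: "scale c (Poly_Mapping.single a d) = Poly_Mapping.single a (c * d)"
  by (rule poly_mapping_eqI) (simp add: lookup_single when_def)

lemma linear_eqI:
  assumes f: "Vector_Spaces.linear scale scale f" and g: "Vector_Spaces.linear scale scale g"
    and eq: "\<And>a. f (Poly_Mapping.single a 1) = g (Poly_Mapping.single a 1)"
  shows "f v = g v"
proof (induction v rule: pm_induct)
  case (single a c)
  have "Poly_Mapping.single a c = scale c (Poly_Mapping.single a 1)" by simp
  then show ?case using eq linearD(2)[OF f] linearD(2)[OF g] by metis
qed (simp add: linearD(1)[OF f] linearD(1)[OF g])


section \<open>The algebra\<close>

datatype uq_gen = K | Kinv | E | F

text \<open>Words form the free monoid, written additively because the convolution product on
  \<open>\<Rightarrow>\<^sub>0\<close> uses \<open>+\<close> on keys. Hence \<open>'k free_alg\<close> is the free unital associative algebra on the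
  generators, with unit the empty word.\<close>

datatype uq_word = Word (letters: "uq_gen list")

instantiation uq_word :: monoid_add
begin
definition zero_uq_word :: uq_word where "0 = Word []"
definition plus_uq_word :: "uq_word \<Rightarrow> uq_word \<Rightarrow> uq_word" where
  "v + w = Word (letters v @ letters w)"
instance by standard (auto simp: zero_uq_word_def plus_uq_word_def)
end

type_synonym 'k free_alg = "uq_word \<Rightarrow>\<^sub>0 'k"

definition gen :: "uq_gen \<Rightarrow> 'k::field free_alg" where
  "gen g = Poly_Mapping.single (Word [g]) 1"

definition const :: "'k::field \<Rightarrow> 'k free_alg" where
  "const c = Poly_Mapping.single 0 c"

definition free_ring :: "'k::field free_alg ring" where
  "free_ring = \<lparr>carrier = UNIV, mult = (*), one = 1, zero = 0, add = (+)\<rparr>"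

definition Uq_relators :: "'k::field \<Rightarrow> 'k free_alg set" where
  "Uq_relators q =
    {gen K * gen Kinv - 1,
     gen Kinv * gen K - 1,
     gen K * gen E - const (q ^ 2) * gen E * gen K,
     gen K * gen F - const (inverse q ^ 2) * gen F * gen K,
     gen E * gen F - gen F * gen E - const (1 / (q - inverse q)) * (gen K - gen Kinv)}"

text \<open>A two-sided ideal of \<open>free_ring\<close> is automatically closed under scalars, since these are
  the elements \<open>const c\<close>.\<close>

definition Uq_ideal :: "'k::field \<Rightarrow> 'k free_alg set" where
  "Uq_ideal q = genideal free_ring (Uq_relators q)"

definition Uq :: "'k::field \<Rightarrow> 'k free_alg set ring" where
  "Uq q = free_ring Quot Uq_ideal q"

definition Uq_class :: "'k::field \<Rightarrow> 'k free_alg \<Rightarrow> 'k free_alg set" where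
  "Uq_class q p = Uq_ideal q +>\<^bsub>free_ring\<^esub> p"

definition Uq_x :: "'k::field \<Rightarrow> 'k free_alg set" where
  "Uq_x q = Uq_class q (gen K)"

definition Uq_xinv :: "'k::field \<Rightarrow> 'k free_alg set" where
  "Uq_xinv q = Uq_class q (gen Kinv)"

definition Uq_y :: "'k::field \<Rightarrow> 'k free_alg set" where
  "Uq_y q = Uq_class q (gen Kinv + gen F * const (q - inverse q))"

definition Uq_z :: "'k::field \<Rightarrow> 'k free_alg set" where
  "Uq_z q = Uq_class q (gen Kinv - gen Kinv * gen E * const (q * (q - inverse q)))"

lemma ring_free_ring: "ring (free_ring :: 'k::field free_alg ring)"
proof (rule ringI)
  show "abelian_group (free_ring :: 'k free_alg ring)"
  proof (rule abelian_groupI)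
    fix p :: "'k free_alg"
    show "\<exists>r\<in>carrier free_ring. r \<oplus>\<^bsub>free_ring\<^esub> p = \<zero>\<^bsub>free_ring\<^esub>"
      by (intro bexI[of _ "- p"]) (simp_all add: free_ring_def)
  qed (simp_all add: free_ring_def algebra_simps)
  show "Group.monoid (free_ring :: 'k free_alg ring)"
    by unfold_locales (simp_all add: free_ring_def algebra_simps)
qed (simp_all add: free_ring_def algebra_simps)

lemma ideal_Uq_ideal: "ideal (Uq_ideal q) free_ring"
  unfolding Uq_ideal_def by (rule ring.genideal_ideal[OF ring_free_ring]) (simp add: free_ring_def)

lemma ring_Uq: "ring (Uq q)"
  unfolding Uq_def by (rule ideal.quotient_is_ring[OF ideal_Uq_ideal])

lemma Uq_class_ring_hom: "Uq_class q \<in> ring_hom free_ring (Uq q)"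
proof -
  have "Uq_class q = (+>\<^bsub>free_ring\<^esub>) (Uq_ideal q)" by (rule ext) (simp add: Uq_class_def)
  then show ?thesis unfolding Uq_def using ideal.rcos_ring_hom[OF ideal_Uq_ideal] by metis
qed

lemma Uq_class_closed: "Uq_class q p \<in> carrier (Uq q)"
  using ring_hom_closed[OF Uq_class_ring_hom] by (simp add: free_ring_def)


section \<open>The module\<close>

text \<open>For \<open>j \<ge> 0\<close> these are the basis vectors; the convention \<open>u_basis i (-1) = 0\<close> is
  extended to all negative \<open>j\<close>.\<close>

definition u_basis :: "int \<Rightarrow> int \<Rightarrow> (int \<times> nat \<Rightarrow>\<^sub>0 'k::field)" where
  "u_basis i j = (if j < 0 then 0 else Poly_Mapping.single (i, nat j) 1)"

definition X_op :: "(int \<times> nat \<Rightarrow>\<^sub>0 'k::field) \<Rightarrow> (int \<times> nat \<Rightarrow>\<^sub>0 'k)" where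
  "X_op = extend (\<lambda>(i, n). u_basis (i + 1) (int n))"

definition Xinv_op :: "(int \<times> nat \<Rightarrow>\<^sub>0 'k::field) \<Rightarrow> (int \<times> nat \<Rightarrow>\<^sub>0 'k)" where
  "Xinv_op = extend (\<lambda>(i, n). u_basis (i - 1) (int n))"

definition Y_op :: "'k::field \<Rightarrow> (int \<times> nat \<Rightarrow>\<^sub>0 'k) \<Rightarrow> (int \<times> nat \<Rightarrow>\<^sub>0 'k)" where
  "Y_op q = extend (\<lambda>(i, n). let j = int n in
     scale (q powi (2 * i - j) * (q powi j - q powi (- j))) (u_basis i (j - 1))
     - scale (q powi i * (q powi i - q powi (- i))) (u_basis (i - 1) j))"

definition Z_op :: "'k::field \<Rightarrow> (int \<times> nat \<Rightarrow>\<^sub>0 'k) \<Rightarrow> (int \<times> nat \<Rightarrow>\<^sub>0 'k)" where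
  "Z_op q = extend (\<lambda>(i, n). let j = int n in
     scale (q powi (- 2 * i)) (u_basis i (j + 1))
     + scale (q powi (- i) * (q powi i - q powi (- i))) (u_basis (i - 1) j))"

text \<open>The actions of \<open>e\<close> and \<open>f\<close> are obtained by solving \<open>z = k\<^sup>-\<^sup>1 - k\<^sup>-\<^sup>1 e q (q - q\<^sup>-\<^sup>1)\<close>
  and \<open>y = k\<^sup>-\<^sup>1 + f (q - q\<^sup>-\<^sup>1)\<close> for \<open>e\<close> and \<open>f\<close>.\<close>

fun gen_op :: "'k::field \<Rightarrow> uq_gen \<Rightarrow> (int \<times> nat \<Rightarrow>\<^sub>0 'k) \<Rightarrow> (int \<times> nat \<Rightarrow>\<^sub>0 'k)" where
  "gen_op q K v = X_op v"
| "gen_op q Kinv v = Xinv_op v"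
| "gen_op q E v = scale (1 / (q * (q - inverse q))) (v - X_op (Z_op q v))"
| "gen_op q F v = scale (1 / (q - inverse q)) (Y_op q v - Xinv_op v)"

definition free_act :: "'k::field \<Rightarrow> 'k free_alg \<Rightarrow> (int \<times> nat \<Rightarrow>\<^sub>0 'k) \<Rightarrow> (int \<times> nat \<Rightarrow>\<^sub>0 'k)" where
  "free_act q p v = extend (\<lambda>w. foldr (gen_op q) (letters w) v) p"

text \<open>An element of \<open>Uq q\<close> acts by the common action of its representatives; that this is a
  module structure with the prescribed action of the equitable generators is proved below.\<close>

definition Gamma_y :: "'k::field \<Rightarrow> 'k free_alg set \<Rightarrow> (int \<times> nat \<Rightarrow>\<^sub>0 'k) \<Rightarrow> (int \<times> nat \<Rightarrow>\<^sub>0 'k)" where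
  "Gamma_y q a = the_elem (free_act q ` a)"

lemma linear_ops:
  "Vector_Spaces.linear scale scale X_op" "Vector_Spaces.linear scale scale Xinv_op"
  "Vector_Spaces.linear scale scale (Y_op q)" "Vector_Spaces.linear scale scale (Z_op q)"
  by (simp_all add: X_op_def Xinv_op_def Y_op_def Z_op_def linear_extend)

lemmas ops_linear [simp] = linear_ops[THEN linearD(1)] linear_ops[THEN linearD(2)]
  linear_ops[THEN linearD(3)] linear_ops[THEN linearD(4)]

lemma X_u [simp]: "X_op (u_basis i j) = u_basis (i + 1) j"
  and Xinv_u [simp]: "Xinv_op (u_basis i j) = u_basis (i - 1) j"
  by (simp_all add: u_basis_def X_op_def Xinv_op_def linear_extend linearD(3) scale_simps)

lemma Y_u: "j \<ge> 0 \<Longrightarrow> Y_op q (u_basis i j) =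
     scale (q powi (2 * i - j) * (q powi j - q powi (- j))) (u_basis i (j - 1))
     - scale (q powi i * (q powi i - q powi (- i))) (u_basis (i - 1) j)"
  by (subst u_basis_def, erule nonneg_int_cases) (simp add: Y_op_def Let_def scale_simps)

lemma Z_u: "j \<ge> 0 \<Longrightarrow> Z_op q (u_basis i j) =
     scale (q powi (- 2 * i)) (u_basis i (j + 1))
     + scale (q powi (- i) * (q powi i - q powi (- i))) (u_basis (i - 1) j)"
  by (subst u_basis_def, erule nonneg_int_cases) (simp add: Z_op_def Let_def scale_simps)

lemma u_neg [simp]: "j < 0 \<Longrightarrow> u_basis i j = 0"
  by (simp add: u_basis_def)

lemma linear_eq_uI:
  assumes "Vector_Spaces.linear scale scale f" "Vector_Spaces.linear scale scale g"
    and "\<And>i j. j \<ge> 0 \<Longrightarrow> f (u_basis i j) = g (u_basis i j)"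
  shows "f v = g v"
proof (rule linear_eqI[OF assms(1,2)])
  fix a :: "int \<times> nat"
  have "Poly_Mapping.single a 1 = u_basis (fst a) (int (snd a))" by (simp add: u_basis_def)
  then show "f (Poly_Mapping.single a 1) = g (Poly_Mapping.single a 1)" using assms(3) by (metis of_nat_0_le_iff)
qed

lemma XXinv [simp]: "X_op (Xinv_op v) = v" "Xinv_op (X_op v) = v"
  by (rule linear_eq_uI[where f = "\<lambda>v. X_op (Xinv_op v)" and g = "\<lambda>v. v"]
           linear_eq_uI[where f = "\<lambda>v. Xinv_op (X_op v)" and g = "\<lambda>v. v"];
      simp add: linear_scale_iff)+

context
  fixes q :: "'k::field"
  assumes q0: "q \<noteq> 0" and q2: "q ^ 2 \<noteq> 1"
begin

lemma qq: "q - inverse q \<noteq> 0"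
  using q0 q2 by (auto simp: field_simps power2_eq_square)

lemma YX: "Y_op q (X_op v) = scale (q ^ 2) (X_op (Y_op q v)) - scale (q ^ 2 - 1) v"
proof (rule linear_eq_uI[where v = v and f = "\<lambda>v. Y_op q (X_op v)" and g = "\<lambda>v. scale (q ^ 2) (X_op (Y_op q v)) - scale (q ^ 2 - 1) v"])
  fix i j :: int assume "j \<ge> 0"
  then show "Y_op q (X_op (u_basis i j)) = scale (q ^ 2) (X_op (Y_op q (u_basis i j))) - scale (q ^ 2 - 1) (u_basis i j)"
    apply (intro poly_mapping_eqI)
    apply (simp add: Y_u lookup_minus lookup_add)
    apply (simp add: power_int_diff power_int_add power_int_minus q0 power_int_mult power2_eq_square)
    apply (simp add: field_simps q0)
    done
qed (simp_all add: linear_scale_iff scale_simps algebra_simps)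

lemma ZX: "Z_op q (X_op v) = scale (1 / q ^ 2) (X_op (Z_op q v)) + scale (1 - 1 / q ^ 2) v"
proof (rule linear_eq_uI[where v = v and f = "\<lambda>v. Z_op q (X_op v)" and g = "\<lambda>v. scale (1 / q ^ 2) (X_op (Z_op q v)) + scale (1 - 1 / q ^ 2) v"])
  fix i j :: int assume "j \<ge> 0"
  then show "Z_op q (X_op (u_basis i j)) =
      scale (1 / q ^ 2) (X_op (Z_op q (u_basis i j))) + scale (1 - 1 / q ^ 2) (u_basis i j)"
    apply (intro poly_mapping_eqI)
    apply (simp add: Z_u lookup_minus lookup_add)
    apply (simp add: power_int_diff power_int_add power_int_minus q0 power_int_mult power2_eq_square)
    apply (simp add: field_simps q0)
    done
qed (simp_all add: linear_scale_iff scale_simps algebra_simps)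

lemma ZY: "Z_op q (Y_op q v) = scale (q ^ 2) (Y_op q (Z_op q v)) - scale (q ^ 2 - 1) v"
proof (rule linear_eq_uI[where v = v and f = "\<lambda>v. Z_op q (Y_op q v)" and g = "\<lambda>v. scale (q ^ 2) (Y_op q (Z_op q v)) - scale (q ^ 2 - 1) v"])
  fix i j :: int assume j: "j \<ge> 0"
  show "Z_op q (Y_op q (u_basis i j)) = scale (q ^ 2) (Y_op q (Z_op q (u_basis i j))) - scale (q ^ 2 - 1) (u_basis i j)"
  proof (cases "j = 0")
    case True
    then show ?thesis
      apply (intro poly_mapping_eqI)
      apply (simp add: Y_u Z_u lookup_minus lookup_add)
      apply (simp add: power_int_diff power_int_add power_int_minus q0 power_int_mult power2_eq_square)
      apply (simp add: field_simps q0)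
      done
  next
    case False
    then show ?thesis using j
      apply (intro poly_mapping_eqI)
      apply (simp add: Y_u Z_u lookup_minus lookup_add)
      apply (simp add: power_int_diff power_int_add power_int_minus q0 power_int_mult power2_eq_square)
      apply (simp add: field_simps q0)
      done
  qed
qed (simp_all add: linear_scale_iff scale_simps algebra_simps)

lemma linear_gen_op: "Vector_Spaces.linear scale scale (gen_op q g)"
  by (cases g) (auto simp: linear_scale_iff scale_simps algebra_simps)

lemma linear_word_op: "Vector_Spaces.linear scale scale (foldr (gen_op q) gs)"
  by (induction gs) (simp_all add: linear_scale_iff linearD[OF linear_gen_op])

lemma free_act_add: "free_act q (p + r) v = free_act q p v + free_act q r v"
  by (simp add: free_act_def linearD[OF linear_extend])

lemma free_act_diff: "free_act q (p - r) v = free_act q p v - free_act q r v"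
  by (simp add: free_act_def linearD[OF linear_extend])

lemma free_act_zero: "free_act q 0 v = 0"
  by (simp add: free_act_def linearD[OF linear_extend])

lemma free_act_single:
  "free_act q (Poly_Mapping.single w c) v = scale c (foldr (gen_op q) (letters w) v)"
  by (simp add: free_act_def)

lemma linear_free_act: "Vector_Spaces.linear scale scale (free_act q p)"
proof (induction p rule: pm_induct)
  case (single w c)
  then show ?case
    by (simp add: linear_scale_iff free_act_single linearD[OF linear_word_op] scale_simps mult.commute)
next
  case (add p r)
  then show ?case by (simp add: linear_scale_iff free_act_add scale_simps add_ac)
qed

lemma free_act_const: "free_act q (const c) v = scale c v"
  by (simp add: const_def free_act_single zero_uq_word_def)

lemma free_act_one: "free_act q 1 v = v"
  using free_act_const[of 1 v] by (simp add: const_def scale_simps)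

lemma free_act_gen: "free_act q (gen g) v = gen_op q g v"
  by (simp add: gen_def free_act_single scale_simps)

lemma free_act_mult: "free_act q (p * r) v = free_act q p (free_act q r v)"
proof (induction p rule: pm_induct)
  case (single w c)
  show ?case
  proof (induction r rule: pm_induct)
    case (single w' d)
    show ?case
      by (simp add: mult_single free_act_single plus_uq_word_def linearD[OF linear_word_op] scale_simps)
  next
    case (add r r')
    then show ?case by (simp add: distrib_left free_act_add linearD[OF linear_free_act])
  qed
next
  case (add p p')
  then show ?case by (simp add: distrib_right free_act_add)
qed

lemmas free_act_simps = free_act_add free_act_diff free_act_zero free_act_const free_act_one
  free_act_gen free_act_mult

lemma free_act_relators: "p \<in> Uq_relators q \<Longrightarrow> free_act q p v = 0"
proof -
  assume "p \<in> Uq_relators q"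
  moreover have "free_act q (gen K * gen Kinv - 1) v = 0" "free_act q (gen Kinv * gen K - 1) v = 0"
    by (simp_all add: free_act_simps)
  moreover have "free_act q (gen K * gen E - const (q ^ 2) * gen E * gen K) v = 0"
  proof -
    obtain d where d: "q - inverse q = d" "d \<noteq> 0" using qq by blast
    show ?thesis
      apply (simp add: free_act_simps ZX scale_simps d)
      apply (intro impI poly_mapping_eqI)
      apply (simp add: lookup_add lookup_minus)
      using q0 d(2) apply (simp add: field_simps power2_eq_square)
      done
  qed
  moreover have "free_act q (gen K * gen F - const (inverse q ^ 2) * gen F * gen K) v = 0"
  proof -
    obtain d where d: "q - inverse q = d" "d \<noteq> 0" using qq by blast
    show ?thesis
      apply (simp add: free_act_simps YX scale_simps d)
      apply (intro impI poly_mapping_eqI)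
      apply (simp add: lookup_add lookup_minus)
      using q0 d(2) apply (simp add: field_simps power2_eq_square)
      done
  qed
  moreover have "free_act q
      (gen E * gen F - gen F * gen E - const (1 / (q - inverse q)) * (gen K - gen Kinv)) v = 0"
  proof -
    have ZXinv: "Z_op q (Xinv_op v) =
        scale (q ^ 2) (Xinv_op (Z_op q v)) - scale (q ^ 2 - 1) (Xinv_op (Xinv_op v))"
    proof -
      have "Xinv_op (Z_op q (X_op (Xinv_op v))) = Xinv_op (scale (1 / q ^ 2)
          (X_op (Z_op q (Xinv_op v))) + scale (1 - 1 / q ^ 2) (Xinv_op v))"
        unfolding ZX ..
      then have *: "Xinv_op (Z_op q v) =
          scale (1 / q ^ 2) (Z_op q (Xinv_op v)) + scale (1 - 1 / q ^ 2) (Xinv_op (Xinv_op v))"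
        by simp
      show ?thesis unfolding *
        by (rule poly_mapping_eqI) (use q0 in \<open>simp add: lookup_add lookup_minus field_simps\<close>)
    qed
    obtain d where d: "q - inverse q = d" "d \<noteq> 0" using qq by blast
    have qd: "q ^ 2 = 1 + q * d" using q0 by (simp add: d(1)[symmetric] field_simps power2_eq_square)
    show ?thesis
      apply (simp add: free_act_simps ZXinv YX ZY scale_simps d)
      apply (intro impI poly_mapping_eqI)
      apply (simp add: lookup_add lookup_minus)
      apply (simp add: qd)
      using q0 d(2) apply (simp add: field_simps)
      done
  qed
  ultimately show ?thesis unfolding Uq_relators_def by blast
qed

lemma free_act_ideal: "p \<in> Uq_ideal q \<Longrightarrow> free_act q p v = 0"
proof -
  let ?J = "{p. \<forall>v. free_act q p v = 0}"
  have neg: "free_act q (- p) v = - free_act q p v" for p v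
    using free_act_diff[of 0 p v] by (simp add: free_act_zero)
  have inv: "\<ominus>\<^bsub>free_ring\<^esub> p = - p" for p :: "'k free_alg"
  proof -
    interpret ring "free_ring :: 'k free_alg ring" by (rule ring_free_ring)
    show ?thesis by (rule minus_equality) (simp_all add: free_ring_def)
  qed
  have "ideal ?J free_ring"
  proof (rule idealI[OF ring_free_ring])
    show "subgroup ?J (add_monoid (free_ring :: 'k free_alg ring))"
    proof (rule group.subgroupI)
      show "Group.group (add_monoid (free_ring :: 'k free_alg ring))"
        by (rule abelian_group.a_group[OF ring.is_abelian_group[OF ring_free_ring]])
      show "?J \<noteq> {}" using free_act_zero by blast
      show "inv\<^bsub>add_monoid free_ring\<^esub> p \<in> ?J" if "p \<in> ?J" for p
        using that inv[of p] by (simp add: a_inv_def neg)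
    qed (auto simp: free_ring_def free_act_simps)
  qed (auto simp: free_ring_def free_act_simps linearD[OF linear_free_act])
  moreover have "Uq_relators q \<subseteq> ?J" using free_act_relators by blast
  ultimately have "Uq_ideal q \<subseteq> ?J" unfolding Uq_ideal_def genideal_def by blast
  then show "p \<in> Uq_ideal q \<Longrightarrow> free_act q p v = 0" by blast
qed

lemma Gamma_y_class: "Gamma_y q (Uq_class q p) = free_act q p"
proof -
  have "0 \<in> Uq_ideal q"
    using additive_subgroup.zero_closed[OF ideal.axioms(1)[OF ideal_Uq_ideal]]
    by (simp add: free_ring_def)
  then have "free_act q ` Uq_class q p = {free_act q p}"
    by (auto simp: Uq_class_def a_r_coset_def' free_ring_def image_iff fun_eq_iff free_act_add
        free_act_ideal intro!: bexI[of _ 0])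
  then show ?thesis by (simp add: Gamma_y_def)
qed

lemma Uq_carrierE:
  assumes "a \<in> carrier (Uq q)" obtains p where "a = Uq_class q p"
  using assms by (auto simp: Uq_def FactRing_def A_RCOSETS_def' Uq_class_def)

theorem Gamma_y_ring_hom: "Gamma_y q \<in> ring_hom (Uq q) End_ring"
proof (rule ring_hom_memI)
  note hom = Uq_class_ring_hom[of q]
  fix a assume "a \<in> carrier (Uq q)"
  then obtain p where a: "a = Uq_class q p" by (rule Uq_carrierE)
  then show "Gamma_y q a \<in> carrier End_ring"
    by (simp add: Gamma_y_class End_ring_def linear_free_act)
  fix b assume "b \<in> carrier (Uq q)"
  then obtain r where b: "b = Uq_class q r" by (rule Uq_carrierE)
  have "a \<otimes>\<^bsub>Uq q\<^esub> b = Uq_class q (p * r)" "a \<oplus>\<^bsub>Uq q\<^esub> b = Uq_class q (p + r)"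
    using ring_hom_mult[OF hom, of p r] ring_hom_add[OF hom, of p r]
    by (simp_all add: a b free_ring_def)
  then show "Gamma_y q (a \<otimes>\<^bsub>Uq q\<^esub> b) = Gamma_y q a \<otimes>\<^bsub>End_ring\<^esub> Gamma_y q b"
    "Gamma_y q (a \<oplus>\<^bsub>Uq q\<^esub> b) = Gamma_y q a \<oplus>\<^bsub>End_ring\<^esub> Gamma_y q b"
    by (simp_all add: a b Gamma_y_class End_ring_def fun_eq_iff free_act_simps)
next
  have "\<one>\<^bsub>Uq q\<^esub> = Uq_class q 1"
    using ring_hom_one[OF Uq_class_ring_hom[of q]] by (simp add: free_ring_def)
  then show "Gamma_y q \<one>\<^bsub>Uq q\<^esub> = \<one>\<^bsub>End_ring\<^esub>"
    by (simp add: Gamma_y_class End_ring_def fun_eq_iff free_act_simps)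
qed

theorem Gamma_y_scalar: "Gamma_y q (Uq_class q (const c)) v = scale c v"
  by (simp add: Gamma_y_class free_act_const)

lemma Gamma_y_ops:
  "Gamma_y q (Uq_x q) = X_op" "Gamma_y q (Uq_xinv q) = Xinv_op"
  "Gamma_y q (Uq_y q) = Y_op q" "Gamma_y q (Uq_z q) = Z_op q"
proof -
  show "Gamma_y q (Uq_x q) = X_op" "Gamma_y q (Uq_xinv q) = Xinv_op"
    by (simp_all add: Uq_x_def Uq_xinv_def Gamma_y_class fun_eq_iff free_act_simps)
  show "Gamma_y q (Uq_y q) = Y_op q"
    using qq by (simp add: Uq_y_def Gamma_y_class fun_eq_iff free_act_simps scale_simps)
  show "Gamma_y q (Uq_z q) = Z_op q"
    using qq q0 by (simp add: Uq_z_def Gamma_y_class fun_eq_iff free_act_simps scale_simps)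
qed

theorem Gamma_y_basis:
  assumes "j \<ge> 0"
  shows "Gamma_y q (Uq_x q) (u_basis i j) = u_basis (i + 1) j"
    and "Gamma_y q (Uq_xinv q) (u_basis i j) = u_basis (i - 1) j"
    and "Gamma_y q (Uq_y q) (u_basis i j) =
      scale (q powi (2 * i - j) * (q powi j - q powi (- j))) (u_basis i (j - 1))
      - scale (q powi i * (q powi i - q powi (- i))) (u_basis (i - 1) j)"
    and "Gamma_y q (Uq_z q) (u_basis i j) =
      scale (q powi (- 2 * i)) (u_basis i (j + 1))
      + scale (q powi (- i) * (q powi i - q powi (- i))) (u_basis (i - 1) j)"
  unfolding Gamma_y_ops using assms by (simp_all only: X_u Xinv_u Y_u Z_u)

end

end

theory Submission
  imports Defs
begin

text \<open>Both coefficients in the formula for \<open>y u\<^sub>i\<^sub>j\<close> have a factor \<open>q\<^sup>r - q\<^sup>-\<^sup>r\<close>, with \<open>r = j\<close> in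
  the first and \<open>r = i\<close> in the second. At \<open>i = j = 0\<close> both vanish, so \<open>y\<close> annihilates the basis
  vector \<open>u\<^sub>0\<^sub>0\<close>. Hence \<open>y\<close> acts on the module with a nonzero kernel, and no linear map inverts it.
  The action is a unital ring homomorphism into the endomorphism ring, and such a homomorphism
  preserves invertibility; therefore \<open>y\<close> has no inverse in the algebra either.\<close>

lemma ring_hom_Units:
  assumes h: "h \<in> ring_hom R S" and a: "a \<in> Units R"
  shows "h a \<in> Units S"
proof -
  from a obtain b where b: "a \<in> carrier R" "b \<in> carrier R"
    "b \<otimes>\<^bsub>R\<^esub> a = \<one>\<^bsub>R\<^esub>" "a \<otimes>\<^bsub>R\<^esub> b = \<one>\<^bsub>R\<^esub>"
    by (auto simp: Units_def)
  have "h b \<otimes>\<^bsub>S\<^esub> h a = \<one>\<^bsub>S\<^esub>" "h a \<otimes>\<^bsub>S\<^esub> h b = \<one>\<^bsub>S\<^esub>"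
    using ring_hom_mult[OF h b(2,1)] ring_hom_mult[OF h b(1,2)] ring_hom_one[OF h] b(3,4)
    by simp_all
  then show ?thesis
    using ring_hom_closed[OF h b(1)] ring_hom_closed[OF h b(2)] by (auto simp: Units_def)
qed

lemma kernel_vector_not_Unit_End_ring:
  assumes "f v = 0" and "v \<noteq> 0"
  shows "f \<notin> Units End_ring"
proof
  assume "f \<in> Units End_ring"
  then obtain g where g: "Vector_Spaces.linear scale scale g" "g \<circ> f = id"
    by (auto simp: Units_def End_ring_def)
  have "v = g (f v)" using g(2) by (metis comp_apply id_apply)
  also have "\<dots> = 0" using assms(1) linearD(3)[OF g(1)] by simp
  finally show False using assms(2) by simp
qed

lemma u_basis_nonzero: "j \<ge> 0 \<Longrightarrow> (u_basis i j :: int \<times> nat \<Rightarrow>\<^sub>0 'k::field) \<noteq> 0"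
  unfolding u_basis_def by (metis lookup_single_eq lookup_zero not_le one_neq_zero)

theorem lemma3p2:
  fixes q :: "'k::field"
  assumes "q \<noteq> 0" and "q ^ 2 \<noteq> 1"
  shows "Gamma_y q (Uq_y q) (u_basis 0 0) = 0
    \<and> Gamma_y q (Uq_y q) \<notin> Units End_ring
    \<and> Uq_y q \<notin> Units (Uq q)"
proof -
  have kernel: "Gamma_y q (Uq_y q) (u_basis 0 0) = 0"
    using Gamma_y_basis(3)[OF assms, of 0 0] by (simp add: scale_simps)
  moreover have not_unit: "Gamma_y q (Uq_y q) \<notin> Units End_ring"
    by (rule kernel_vector_not_Unit_End_ring[where v = "u_basis 0 0"])
      (simp_all add: kernel u_basis_nonzero)
  moreover have "Uq_y q \<notin> Units (Uq q)"
    using ring_hom_Units[OF Gamma_y_ring_hom[OF assms]] not_unit by blast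
  ultimately show ?thesis by blast
qed

end
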